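(* Let $n$ be a positive integer. An fb-tableau of size $n$ is in the spine of $\operatorname{esTam}_n$ if and only if it does not contain a forbidden cohook.
   Context: Let $n$ be a positive integer. The board of size $n$ is the Ferrers diagram of shape $(n,n,n-1,n-2,\dots,3,2)$ (a single cell $(1,1)$ if $n=1$). Its cells are written $(i,j)$, where $i$ is the row, numbered from the top, and $j$ is the column label, the columns being labelled $n,n-1,\dots,1$ from left to right. So the cells are $(1,j)$ for $1\le j\le n$ and $(i,j)$ for $2\le i\le n$, $i-1\le j\le n$. The root is $(1,n)$ (top-left cell); the border cells are $(i,i-1)$ for $2\le i\le n$ (the rightmost cells of rows $2,\dots,n$). An fb-tableau of size $n$ is a filling in which each cell is either empty or nonempty such that the root and all border cells are nonempty, and every nonempty cell other than the root has a nonempty cell strictly to its left in the same row or strictly above it in the same column. In an fb-tableau, a nonempty cell different from the root is called a left-arrow if there is no nonempty cell strictly to its left in its row, an up-arrow if there is no nonempty cell strictly above it in its column, and a dot otherwise; the root is also a dot. (Each of rows $2,\dots,n$ has exactly one left-arrow, each of columns $1,\dots,n-1$ has exactly one up-arrow.) A cell is free in $T$ if it lies strictly below an up-arrow (same column) and strictly to the right of a left-arrow (same row); a free cell is either empty or contains a dot. $\operatorname{Row}(T)$ is the set of cells lying weakly to the right of a left-arrow or of the root in the same row; $\operatorname{Col}(T)$ is the set of cells lying weakly below an up-arrow or the root in the same column. For fb-tableaux $S,T$ of size $n$, write $S\lhd T$ if (1) $\operatorname{Col}(S)\subseteq\operatorname{Col}(T)$; (2) $\operatorname{Row}(T)\subseteq\operatorname{Row}(S)$;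 (3) for every cell $c$ that is free in both $S$ and $T$, if $c$ contains a dot in $S$ then $c$ contains a dot in $T$. The extra slow Tamari lattice $\operatorname{esTam}_n$ is the set of fb-tableaux of size $n$ ordered by $\lhd$; it is a finite (trim) lattice. Its spine is the set of elements that belong to some chain of maximum length. The cohook $H(i,j)$ of a cell $(i,j)$ is the set consisting of $(i,j)$, all cells to its left in row $i$, and all cells above it in column $j$. In an fb-tableau, $H(i,j)$ is a forbidden cohook if every cell of $H(i,j)$ is empty. *)

theory Defs
  imports Main
begin

text \<open>A cell is a pair \<open>(i, j)\<close> of a row number \<open>i\<close> (counted from the top, starting at 1) and a column
  label \<open>j\<close>.  Columns are labelled \<open>n, n - 1, \<dots>, 1\<close> from left to right, so a cell of the same row
  lies further to the left iff its label is \<^emph>\<open>larger\<close>.\<close>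

type_synonym cell = "nat \<times> nat"

text \<open>For \<open>i = 1\<close> the truncated bound \<open>i - 1 = 0\<close> is vacuous, so row 1 is \<open>1 \<le> j \<le> n\<close>.\<close>

definition board :: "nat \<Rightarrow> cell set" where
  "board n = {(i, j). 1 \<le> i \<and> i \<le> n \<and> 1 \<le> j \<and> i - 1 \<le> j \<and> j \<le> n}"

definition root :: "nat \<Rightarrow> cell" where
  "root n = (1, n)"

definition border :: "nat \<Rightarrow> cell set" where
  "border n = {(i, i - 1) | i. 2 \<le> i \<and> i \<le> n}"

definition is_left_of :: "cell \<Rightarrow> cell \<Rightarrow> bool" where
  "is_left_of d c \<longleftrightarrow> fst d = fst c \<and> snd d > snd c"

definition is_above :: "cell \<Rightarrow> cell \<Rightarrow> bool" where
  "is_above d c \<longleftrightarrow> snd d = snd c \<and> fst d < fst c"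

text \<open>A filling is represented by its set of nonempty cells.\<close>

definition fb_tableau :: "nat \<Rightarrow> cell set \<Rightarrow> bool" where
  "fb_tableau n T \<longleftrightarrow>
     T \<subseteq> board n \<and> root n \<in> T \<and> border n \<subseteq> T \<and>
     (\<forall>c \<in> T - {root n}. \<exists>d \<in> T. is_left_of d c \<or> is_above d c)"

definition left_arrow :: "nat \<Rightarrow> cell set \<Rightarrow> cell \<Rightarrow> bool" where
  "left_arrow n T c \<longleftrightarrow> c \<in> T \<and> c \<noteq> root n \<and> \<not> (\<exists>d \<in> T. is_left_of d c)"

definition up_arrow :: "nat \<Rightarrow> cell set \<Rightarrow> cell \<Rightarrow> bool" where
  "up_arrow n T c \<longleftrightarrow> c \<in> T \<and> c \<noteq> root n \<and> \<not> (\<exists>d \<in> T. is_above d c)"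

definition dot :: "nat \<Rightarrow> cell set \<Rightarrow> cell \<Rightarrow> bool" where
  "dot n T c \<longleftrightarrow> c \<in> T \<and> (c = root n \<or> \<not> left_arrow n T c \<and> \<not> up_arrow n T c)"

definition free :: "nat \<Rightarrow> cell set \<Rightarrow> cell \<Rightarrow> bool" where
  "free n T c \<longleftrightarrow> c \<in> board n \<and>
     (\<exists>u. up_arrow n T u \<and> is_above u c) \<and> (\<exists>l. left_arrow n T l \<and> is_left_of l c)"

definition Row :: "nat \<Rightarrow> cell set \<Rightarrow> cell set" where
  "Row n T = {c \<in> board n. \<exists>d. (left_arrow n T d \<or> d = root n) \<and> (d = c \<or> is_left_of d c)}"

definition Col :: "nat \<Rightarrow> cell set \<Rightarrow> cell set" where
  "Col n T = {c \<in> board n. \<exists>d. (up_arrow n T d \<or> d = root n) \<and> (d = c \<or> is_above d c)}"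

definition fb_le :: "nat \<Rightarrow> cell set \<Rightarrow> cell set \<Rightarrow> bool" where
  "fb_le n S T \<longleftrightarrow>
     Col n S \<subseteq> Col n T \<and> Row n T \<subseteq> Row n S \<and>
     (\<forall>c. free n S c \<and> free n T c \<and> dot n S c \<longrightarrow> dot n T c)"

definition esTam :: "nat \<Rightarrow> cell set rel" where
  "esTam n = {(S, T). fb_tableau n S \<and> fb_tableau n T \<and> fb_le n S T}"

text \<open>For reflexive \<open>r\<close>, \<open>Chains r\<close> consists of the subsets of \<open>Field r\<close> that are totally ordered
  by \<open>r\<close>.  Comparing lengths by \<open>card\<close> is adequate because the posets considered are finite.\<close>

definition spine :: "'a rel \<Rightarrow> 'a set" where
  "spine r = {x. \<exists>C \<in> Chains r. x \<in> C \<and> (\<forall>D \<in> Chains r. card D \<le> card C)}"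

definition cohook :: "nat \<Rightarrow> cell \<Rightarrow> cell set" where
  "cohook n c = {d \<in> board n. d = c \<or> is_left_of d c \<or> is_above d c}"

definition contains_forbidden_cohook :: "nat \<Rightarrow> cell set \<Rightarrow> bool" where
  "contains_forbidden_cohook n T \<longleftrightarrow> (\<exists>c \<in> board n. cohook n c \<inter> T = {})"

lemma finite_board: "finite (board n)"
  by (rule finite_subset[of _ "{..n} \<times> {..n}"]) (auto simp: board_def)

lemma finite_fb_tableaux: "finite {T. fb_tableau n T}"
  by (rule finite_subset[of _ "Pow (board n)"]) (auto simp: fb_tableau_def finite_board)

lemma Field_esTam: "Field (esTam n) = {T. fb_tableau n T}"
  by (auto simp: Field_def esTam_def fb_le_def)

lemma up_arrow_above:
  assumes "fb_tableau n T" "c \<in> T" "snd c \<noteq> n"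
  shows "\<exists>u. up_arrow n T u \<and> (u = c \<or> is_above u c)"
  using assms(2,3)
proof (induction "fst c" arbitrary: c rule: less_induct)
  case less
  show ?case
  proof (cases "\<exists>d \<in> T. is_above d c")
    case True
    then obtain d where d: "d \<in> T" "is_above d c" by blast
    with less have "\<exists>u. up_arrow n T u \<and> (u = d \<or> is_above u d)"
      by (intro less.hyps) (auto simp: is_above_def)
    then obtain u where u: "up_arrow n T u" "u = d \<or> is_above u d" by blast
    with d have "is_above u c" by (auto simp: is_above_def)
    with u show ?thesis by blast
  next
    case False
    with less.prems have "up_arrow n T c" by (auto simp: up_arrow_def root_def)
    then show ?thesis by blast
  qed
qed

lemma left_arrow_left:
  assumes "fb_tableau n T" "c \<in> T" "fst c \<noteq> 1"
  shows "\<exists>u. left_arrow n T u \<and> (u = c \<or> is_left_of u c)"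
  using assms(2,3)
proof (induction "n - snd c" arbitrary: c rule: less_induct)
  case less
  show ?case
  proof (cases "\<exists>d \<in> T. is_left_of d c")
    case True
    then obtain d where d: "d \<in> T" "is_left_of d c" by blast
    moreover have "snd d \<le> n" using d assms(1) by (auto simp: fb_tableau_def board_def)
    ultimately have "\<exists>u. left_arrow n T u \<and> (u = d \<or> is_left_of u d)"
      using less.prems by (intro less.hyps) (auto simp: is_left_of_def)
    then obtain u where u: "left_arrow n T u" "u = d \<or> is_left_of u d" by blast
    with d have "is_left_of u c" by (auto simp: is_left_of_def)
    with u show ?thesis by blast
  next
    case False
    with less.prems have "left_arrow n T c" by (auto simp: left_arrow_def root_def)
    then show ?thesis by blast
  qed
qed

lemma Row_iff:
  assumes "fb_tableau n T" "c \<in> board n"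
  shows "c \<in> Row n T \<longleftrightarrow> fst c = 1 \<or> (\<exists>d \<in> T. d = c \<or> is_left_of d c)"
proof
  assume "c \<in> Row n T"
  then show "fst c = 1 \<or> (\<exists>d \<in> T. d = c \<or> is_left_of d c)"
    unfolding Row_def left_arrow_def by (auto simp: root_def is_left_of_def[of "(Suc 0, n)"])
next
  assume *: "fst c = 1 \<or> (\<exists>d \<in> T. d = c \<or> is_left_of d c)"
  show "c \<in> Row n T"
  proof (cases "fst c = 1")
    case True
    then have "root n = c \<or> is_left_of (root n) c"
      using assms(2) by (auto simp: root_def is_left_of_def board_def)
    then show ?thesis using assms(2) unfolding Row_def by blast
  next
    case False
    with * obtain d where d: "d \<in> T" "d = c \<or> is_left_of d c" by blast
    with False have "fst d \<noteq> 1" by (auto simp: is_left_of_def)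
    with left_arrow_left[OF assms(1) d(1)] obtain u
      where u: "left_arrow n T u" "u = d \<or> is_left_of u d" by blast
    then have "u = c \<or> is_left_of u c" using d by (auto simp: is_left_of_def)
    with u(1) assms(2) show ?thesis unfolding Row_def by blast
  qed
qed

lemma Col_iff:
  assumes "fb_tableau n T" "c \<in> board n"
  shows "c \<in> Col n T \<longleftrightarrow> snd c = n \<or> (\<exists>d \<in> T. d = c \<or> is_above d c)"
proof
  assume "c \<in> Col n T"
  then show "snd c = n \<or> (\<exists>d \<in> T. d = c \<or> is_above d c)"
    unfolding Col_def up_arrow_def by (auto simp: root_def is_above_def[of "(Suc 0, n)"])
next
  assume *: "snd c = n \<or> (\<exists>d \<in> T. d = c \<or> is_above d c)"
  show "c \<in> Col n T"
  proof (cases "snd c = n")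
    case True
    then have "root n = c \<or> is_above (root n) c"
      using assms(2) by (auto simp: root_def is_above_def board_def)
    then show ?thesis using assms(2) unfolding Col_def by blast
  next
    case False
    with * obtain d where d: "d \<in> T" "d = c \<or> is_above d c" by blast
    with False have "snd d \<noteq> n" by (auto simp: is_above_def)
    with up_arrow_above[OF assms(1) d(1)] obtain u
      where u: "up_arrow n T u" "u = d \<or> is_above u d" by blast
    then have "u = c \<or> is_above u c" using d by (auto simp: is_above_def)
    with u(1) assms(2) show ?thesis unfolding Col_def by blast
  qed
qed

lemma up_arrow_col: "fb_tableau n T \<Longrightarrow> up_arrow n T u \<Longrightarrow> snd u \<noteq> n"
  by (cases u) (force simp: fb_tableau_def up_arrow_def is_above_def root_def board_def)

lemma left_arrow_row: "fb_tableau n T \<Longrightarrow> left_arrow n T u \<Longrightarrow> fst u \<noteq> 1"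
  by (cases u) (force simp: fb_tableau_def left_arrow_def is_left_of_def root_def board_def)

lemma free_iff:
  assumes "fb_tableau n T" "c \<in> board n"
  shows "free n T c \<longleftrightarrow> fst c \<noteq> 1 \<and> snd c \<noteq> n \<and> (\<exists>d \<in> T. is_above d c) \<and> (\<exists>d \<in> T. is_left_of d c)"
proof
  assume "free n T c"
  then show "fst c \<noteq> 1 \<and> snd c \<noteq> n \<and> (\<exists>d \<in> T. is_above d c) \<and> (\<exists>d \<in> T. is_left_of d c)"
    using up_arrow_col[OF assms(1)] left_arrow_row[OF assms(1)]
    unfolding free_def left_arrow_def up_arrow_def by (metis is_above_def is_left_of_def)
next
  assume *: "fst c \<noteq> 1 \<and> snd c \<noteq> n \<and> (\<exists>d \<in> T. is_above d c) \<and> (\<exists>d \<in> T. is_left_of d c)"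
  then obtain a l where al: "a \<in> T" "is_above a c" "l \<in> T" "is_left_of l c" by blast
  with * have "snd a \<noteq> n" "fst l \<noteq> 1" by (auto simp: is_above_def is_left_of_def)
  with up_arrow_above[OF assms(1) al(1)] left_arrow_left[OF assms(1) al(3)] obtain u v
    where uv: "up_arrow n T u" "u = a \<or> is_above u a" "left_arrow n T v" "v = l \<or> is_left_of v l"
    by blast
  with al have "is_above u c" "is_left_of v c" by (auto simp: is_above_def is_left_of_def)
  with uv assms(2) show "free n T c" unfolding free_def by blast
qed

lemma free_iff_Row_Col:
  assumes "fb_tableau n T" "(i, j) \<in> board n"
  shows "free n T (i, j) \<longleftrightarrow>
    i \<noteq> 1 \<and> j \<noteq> n \<and> (i - 1, j) \<in> Col n T \<and> (i, j + 1) \<in> Row n T"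
proof (cases "i \<noteq> 1 \<and> j \<noteq> n")
  case True
  then have b: "(i - 1, j) \<in> board n" "(i, j + 1) \<in> board n"
    using assms(2) by (auto simp: board_def)
  have i: "0 < i" using assms(2) by (auto simp: board_def)
  have "(\<exists>d \<in> T. is_above d (i, j)) \<longleftrightarrow> (\<exists>d \<in> T. d = (i - 1, j) \<or> is_above d (i - 1, j))"
  proof (rule bex_cong[OF refl])
    fix d show "is_above d (i, j) \<longleftrightarrow> d = (i - 1, j) \<or> is_above d (i - 1, j)"
      using i by (cases d) (auto simp: is_above_def)
  qed
  moreover have "(\<exists>d \<in> T. is_left_of d (i, j)) \<longleftrightarrow> (\<exists>d \<in> T. d = (i, j + 1) \<or> is_left_of d (i, j + 1))"
  proof (rule bex_cong[OF refl])
    fix d show "is_left_of d (i, j) \<longleftrightarrow> d = (i, j + 1) \<or> is_left_of d (i, j + 1)"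
      by (cases d) (auto simp: is_left_of_def)
  qed
  ultimately show ?thesis
    using True free_iff[OF assms] Row_iff[OF assms(1) b(2)] Col_iff[OF assms(1) b(1)] by auto
next
  case False
  then show ?thesis using free_iff[OF assms] by auto
qed

lemma mem_fb_tableau_iff:
  assumes "fb_tableau n T" "c \<in> board n" "c \<noteq> root n"
  shows "c \<in> T \<longleftrightarrow> c \<in> Row n T \<and> c \<in> Col n T \<and> (free n T c \<longrightarrow> dot n T c)"
proof
  assume "c \<in> T"
  then show "c \<in> Row n T \<and> c \<in> Col n T \<and> (free n T c \<longrightarrow> dot n T c)"
    using assms(3) by (auto simp: Row_iff[OF assms(1,2)] Col_iff[OF assms(1,2)]
        free_iff[OF assms(1,2)] dot_def left_arrow_def up_arrow_def)
next
  assume *: "c \<in> Row n T \<and> c \<in> Col n T \<and> (free n T c \<longrightarrow> dot n T c)"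
  show "c \<in> T"
  proof (rule ccontr)
    assume nT: "c \<notin> T"
    with * have nf: "\<not> free n T c" by (auto simp: dot_def)
    have r: "root n \<in> T" using assms(1) by (simp add: fb_tableau_def)
    have "fst c = 1 \<or> (\<exists>d \<in> T. is_left_of d c)" "snd c = n \<or> (\<exists>d \<in> T. is_above d c)"
      using * nT by (auto simp: Row_iff[OF assms(1,2)] Col_iff[OF assms(1,2)])
    with nf have e: "fst c = 1 \<or> snd c = n" using free_iff[OF assms(1,2)] by blast
    show False
    proof (cases "fst c = 1")
      case True
      with assms(3) have "snd c \<noteq> n" by (cases c) (auto simp: root_def)
      with * nT obtain d where "d \<in> T" "is_above d c" by (auto simp: Col_iff[OF assms(1,2)])
      with True assms(1) show False by (cases d) (auto simp: fb_tableau_def is_above_def board_def)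
    next
      case False
      with * nT obtain d where "d \<in> T" "is_left_of d c" by (auto simp: Row_iff[OF assms(1,2)])
      with e False assms(1) show False
        by (cases d) (auto simp: fb_tableau_def is_left_of_def board_def)
    qed
  qed
qed

lemma partial_order_esTam: "partial_order_on {T. fb_tableau n T} (esTam n)"
proof -
  have tr: "fb_le n S U"
    if T: "fb_tableau n S" "fb_tableau n T" "fb_tableau n U" "fb_le n S T" "fb_le n T U" for S T U
    unfolding fb_le_def
  proof (intro conjI allI impI)
    show "Col n S \<subseteq> Col n U" "Row n U \<subseteq> Row n S" using T(4,5) by (auto simp: fb_le_def)
    fix c assume c: "free n S c \<and> free n U c \<and> dot n S c"
    obtain i j where ij: "c = (i, j)" by (cases c)
    have b: "(i, j) \<in> board n" using c ij by (auto simp: free_def)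
    have fT: "free n T c"
      using c T(4,5) free_iff_Row_Col[OF T(1) b] free_iff_Row_Col[OF T(2) b]
        free_iff_Row_Col[OF T(3) b] by (auto simp: ij fb_le_def)
    with c T(4,5) show "dot n U c" unfolding fb_le_def by blast
  qed
  have an: "S = T"
    if T: "fb_tableau n S" "fb_tableau n T" "fb_le n S T" "fb_le n T S" for S T
  proof -
    have RC: "Row n S = Row n T" "Col n S = Col n T" using T(3,4) by (auto simp: fb_le_def)
    have "c \<in> S \<longleftrightarrow> c \<in> T" if b: "c \<in> board n" for c
    proof (cases "c = root n")
      case True
      with T(1,2) show ?thesis by (simp add: fb_tableau_def)
    next
      case False
      have "free n S c \<longleftrightarrow> free n T c"
        using b RC free_iff_Row_Col[OF T(1)] free_iff_Row_Col[OF T(2)] by (cases c) simp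
      with T(3,4) RC show ?thesis
        unfolding mem_fb_tableau_iff[OF T(1) b False] mem_fb_tableau_iff[OF T(2) b False] fb_le_def
        by blast
    qed
    with T(1,2) show ?thesis by (auto simp: fb_tableau_def)
  qed
  show ?thesis
    unfolding partial_order_on_def preorder_on_def
  proof (intro conjI)
    show "esTam n \<subseteq> {T. fb_tableau n T} \<times> {T. fb_tableau n T}" by (auto simp: esTam_def)
    show "refl_on {T. fb_tableau n T} (esTam n)"
      by (auto simp: refl_on_def esTam_def fb_le_def)
    show "trans (esTam n)" using tr by (auto simp: esTam_def intro!: transI)
    show "antisym (esTam n)" using an by (auto simp: esTam_def intro!: antisymI)
  qed
qed

end

theory Submission
  imports Defs
begin

text \<open>Record a tableau \<open>T\<close> by the set consisting of the cells of \<open>Col(T)\<close>, the cells outside \<open>Row(T)\<close>,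
  and the cells whose period of being free is over, or whose dot has been placed.  Climbing in the
  lattice only adds elements to this record, so chains of tableaux are chains of sets.  The only
  cells for which the third part is ambiguous are those outside \<open>Row(T) \<union> Col(T)\<close>, that is, those whose
  cohook is forbidden: counting them or not gives two strictly increasing rank functions with the
  same range.  A chain that is long enough to exhaust the range forces the two ranks to agree, so a
  spine element has no forbidden cohook.  Conversely, from a tableau without forbidden cohooks one
  can always climb or descend by a single element of the record to another such tableau.\<close>

section \<open>Chains in families of finite sets\<close>

text \<open>Each step enlarges the record \<open>E\<close> by one element, so a climb inside the
  finite set \<open>U\<close> must stop, and it can stop only where \<open>P\<close> holds. The
  final equation is saturation: no cardinality between \<open>E x\<close> and \<open>E t\<close> is
  skipped.\<close>

lemma saturated_chain_above:
  fixes E :: "'a \<Rightarrow> 'b set"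
  assumes U: "finite U" "\<And>x. E x \<subseteq> U"
    and step: "\<forall>x \<in> G. P x \<or> (\<exists>y \<in> G. \<exists>e. e \<notin> E x \<and> E y = insert e (E x))"
    and "x \<in> G"
  shows "\<exists>C t. C \<subseteq> G \<and> finite C \<and> x \<in> C \<and> t \<in> C \<and> P t \<and> (\<forall>y \<in> C. E x \<subseteq> E y) \<and>
    (\<forall>y \<in> C. \<forall>z \<in> C. E y \<subseteq> E z \<or> E z \<subseteq> E y) \<and> card (E x) + card C = card (E t) + 1"
  using \<open>x \<in> G\<close>
proof (induction "card U - card (E x)" arbitrary: x rule: less_induct)
  case less
  consider "P x" | y e where "y \<in> G" "e \<notin> E x" "E y = insert e (E x)"
    using step less.prems by blast
  then show ?case
  proof cases
    case 1
    then show ?thesis using less.prems by (intro exI[of _ "{x}"] exI[of _ x]) auto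
  next
    case 2
    have fin: "finite (E x)" using U finite_subset by blast
    have y: "card (E y) = Suc (card (E x))" using 2 fin by simp
    moreover have "card (E y) \<le> card U" using U card_mono by blast
    ultimately have "card U - card (E y) < card U - card (E x)" by simp
    from less.hyps[OF this 2(1)] obtain C t where
      C: "C \<subseteq> G" "finite C" "y \<in> C" "t \<in> C" "P t" "\<forall>z \<in> C. E y \<subseteq> E z"
      "\<forall>y \<in> C. \<forall>z \<in> C. E y \<subseteq> E z \<or> E z \<subseteq> E y" "card (E y) + card C = card (E t) + 1"
      by metis
    have "x \<notin> C" using C(6) 2 by blast
    moreover have "\<forall>z \<in> insert x C. E x \<subseteq> E z" using C(6) 2(3) by blast
    ultimately show ?thesis
      using C less.prems y by (intro exI[of _ "insert x C"] exI[of _ t]) auto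
  qed
qed

text \<open>Descent mirrors the climb: \<open>card (E x)\<close> drops by one at each step, so it
  ends where \<open>P\<close> holds.\<close>

lemma saturated_chain_below:
  fixes E :: "'a \<Rightarrow> 'b set"
  assumes fin: "\<And>x. finite (E x)"
    and step: "\<forall>x \<in> G. P x \<or> (\<exists>y \<in> G. \<exists>e. e \<notin> E y \<and> E x = insert e (E y))"
    and "x \<in> G"
  shows "\<exists>C t. C \<subseteq> G \<and> finite C \<and> x \<in> C \<and> t \<in> C \<and> P t \<and> (\<forall>y \<in> C. E y \<subseteq> E x) \<and>
    (\<forall>y \<in> C. \<forall>z \<in> C. E y \<subseteq> E z \<or> E z \<subseteq> E y) \<and> card (E t) + card C = card (E x) + 1"
  using \<open>x \<in> G\<close>
proof (induction "card (E x)" arbitrary: x rule: less_induct)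
  case less
  consider "P x" | y e where "y \<in> G" "e \<notin> E y" "E x = insert e (E y)"
    using step less.prems by blast
  then show ?case
  proof cases
    case 1
    then show ?thesis using less.prems by (intro exI[of _ "{x}"] exI[of _ x]) auto
  next
    case 2
    have x: "card (E x) = Suc (card (E y))" using 2 fin by simp
    then have "card (E y) < card (E x)" by simp
    from less.hyps[OF this 2(1)] obtain C t where
      C: "C \<subseteq> G" "finite C" "y \<in> C" "t \<in> C" "P t" "\<forall>z \<in> C. E z \<subseteq> E y"
      "\<forall>y \<in> C. \<forall>z \<in> C. E y \<subseteq> E z \<or> E z \<subseteq> E y" "card (E t) + card C = card (E y) + 1"
      by metis
    have "x \<notin> C" using C(6) 2 by blast
    moreover have "\<forall>z \<in> insert x C. E z \<subseteq> E x" using C(6) 2(3) by blast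
    ultimately show ?thesis
      using C less.prems x by (intro exI[of _ "insert x C"] exI[of _ t]) auto
  qed
qed

text \<open>The values below \<open>f x\<close> fill \<open>{a..<f x}\<close> without gaps, so
  \<open>f x\<close> can be read off from the number of smaller members of \<open>C\<close>. Two
  such bijections that order \<open>C\<close> alike and share the lower end \<open>a\<close>
  therefore agree.\<close>

lemma bij_betw_rank:
  fixes f :: "'a \<Rightarrow> nat"
  assumes "bij_betw f C {a..b}" "x \<in> C"
  shows "f x = a + card {y \<in> C. f y < f x}"
proof -
  have im: "f ` C = {a..b}" "inj_on f C" using assms(1) by (auto simp: bij_betw_def)
  have fx: "f x \<in> {a..b}" using im(1) assms(2) by blast
  have "f ` {y \<in> C. f y < f x} = {a..<f x}"
  proof (intro set_eqI iffI)
    fix k assume "k \<in> {a..<f x}"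
    moreover from this have "k \<in> f ` C" using im(1) fx by auto
    ultimately show "k \<in> f ` {y \<in> C. f y < f x}" by auto
  qed (use im(1) in auto)
  moreover have "card (f ` {y \<in> C. f y < f x}) = card {y \<in> C. f y < f x}"
    by (rule card_image) (rule inj_on_subset[OF im(2)], auto)
  ultimately have "f x - a = card {y \<in> C. f y < f x}" by simp
  then show ?thesis using fx by (metis atLeastAtMost_iff le_add_diff_inverse)
qed

section \<open>Tableaux as triples\<close>

text \<open>\<open>r i\<close> is the column of the left-arrow in row \<open>i\<close> and \<open>c j\<close> the row of the up-arrow in column \<open>j\<close>;
  the root plays both parts for row 1 and column \<open>n\<close>.\<close>

definition valid :: "nat \<Rightarrow> (nat \<Rightarrow> nat) \<Rightarrow> (nat \<Rightarrow> nat) \<Rightarrow> bool" where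
  "valid n r c \<longleftrightarrow> r 1 = n \<and> c n = 1 \<and>
     (\<forall>i. 2 \<le> i \<and> i \<le> n \<longrightarrow> i - 1 \<le> r i \<and> r i \<le> n \<and> c (r i) < i) \<and>
     (\<forall>j. 1 \<le> j \<and> j < n \<longrightarrow> 1 \<le> c j \<and> c j \<le> j + 1 \<and> j < r (c j))"

text \<open>The condition \<open>i \<le> j\<close> exempts the border, whose cells are nonempty even when free.\<close>

definition build :: "nat \<Rightarrow> (nat \<Rightarrow> nat) \<Rightarrow> (nat \<Rightarrow> nat) \<Rightarrow> cell set \<Rightarrow> cell set" where
  "build n r c D = {(i, j). (i, j) \<in> board n \<and> c j \<le> i \<and> j \<le> r i \<and>
     (c j < i \<and> j < r i \<and> i \<le> j \<longrightarrow> (i, j) \<in> D)}"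

lemma left_end_in_build:
  assumes "valid n r c" "1 \<le> i" "i \<le> n"
  shows "(i, r i) \<in> build n r c D"
proof (cases "i = 1")
  case True
  then show ?thesis using assms by (auto simp: build_def valid_def board_def)
next
  case False
  with assms have i: "2 \<le> i" "i \<le> n" by auto
  with assms(1) have "i - 1 \<le> r i" "r i \<le> n" "c (r i) < i" by (auto simp: valid_def)
  with i show ?thesis by (auto simp: build_def board_def)
qed

lemma top_end_in_build:
  assumes "valid n r c" "1 \<le> j" "j \<le> n"
  shows "(c j, j) \<in> build n r c D"
proof (cases "j = n")
  case True
  then show ?thesis using assms by (auto simp: build_def valid_def board_def)
next
  case False
  with assms have j: "1 \<le> j" "j < n" by auto
  with assms(1) have "1 \<le> c j" "c j \<le> j + 1" "j < r (c j)" by (auto simp: valid_def)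
  with j show ?thesis by (auto simp: build_def board_def)
qed

lemma fb_tableau_build:
  assumes "n > 0" "valid n r c"
  shows "fb_tableau n (build n r c D)"
  unfolding fb_tableau_def
proof (intro conjI ballI)
  show "build n r c D \<subseteq> board n" by (auto simp: build_def)
  show "root n \<in> build n r c D" using top_end_in_build[OF assms(2), of n D] assms
    by (auto simp: root_def valid_def)
  show "border n \<subseteq> build n r c D"
  proof
    fix x assume "x \<in> border n"
    then obtain i where i: "x = (i, i - 1)" "2 \<le> i" "i \<le> n" by (auto simp: border_def)
    then have "1 \<le> i - 1" "i - 1 < n" by auto
    with i have "i - 1 \<le> r i" "c (i - 1) \<le> i - 1 + 1" using assms(2) unfolding valid_def by blast+
    then show "x \<in> build n r c D" using i by (auto simp: build_def board_def)
  qed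
  fix x assume x: "x \<in> build n r c D - {root n}"
  obtain i j where ij: "x = (i, j)" by (cases x)
  with x have b: "(i, j) \<in> board n" "c j \<le> i" "j \<le> r i" "(i, j) \<noteq> (1, n)"
    by (auto simp: build_def root_def)
  \<comment> \<open>A cell below the top end of its column is supported by that end. Otherwise it is
    itself the top end of a column other than \<open>n\<close>, and \<open>j < r (c j)\<close>
    yields a support on its left.\<close>
  show "\<exists>d \<in> build n r c D. is_left_of d x \<or> is_above d x"
  proof (cases "c j < i")
    case True
    moreover have "(c j, j) \<in> build n r c D"
      using b(1) top_end_in_build[OF assms(2)] by (auto simp: board_def)
    ultimately show ?thesis unfolding ij is_above_def by (metis fst_conv snd_conv)
  next
    case False
    with b have i: "c j = i" "j \<noteq> n" using assms(2) by (auto simp: valid_def)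
    with b(1) have "j < r i" using assms(2) by (auto simp: valid_def board_def)
    moreover have "(i, r i) \<in> build n r c D"
      using b(1) left_end_in_build[OF assms(2)] by (auto simp: board_def)
    ultimately show ?thesis unfolding ij is_left_of_def by (metis fst_conv snd_conv)
  qed
qed

lemma Row_build:
  assumes "n > 0" "valid n r c" "(i, j) \<in> board n"
  shows "(i, j) \<in> Row n (build n r c D) \<longleftrightarrow> j \<le> r i"
proof
  assume "(i, j) \<in> Row n (build n r c D)"
  then show "j \<le> r i"
    using assms(2,3) unfolding Row_iff[OF fb_tableau_build[OF assms(1,2)] assms(3)]
    by (auto simp: build_def is_left_of_def valid_def board_def)
next
  assume "j \<le> r i"
  moreover have "(i, r i) \<in> build n r c D"
    using assms(3) left_end_in_build[OF assms(2)] by (auto simp: board_def)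
  ultimately show "(i, j) \<in> Row n (build n r c D)"
    unfolding Row_iff[OF fb_tableau_build[OF assms(1,2)] assms(3)] is_left_of_def
    by (metis fst_conv snd_conv le_neq_implies_less)
qed

lemma Col_build:
  assumes "n > 0" "valid n r c" "(i, j) \<in> board n"
  shows "(i, j) \<in> Col n (build n r c D) \<longleftrightarrow> c j \<le> i"
proof
  assume "(i, j) \<in> Col n (build n r c D)"
  then show "c j \<le> i"
    using assms(2,3) unfolding Col_iff[OF fb_tableau_build[OF assms(1,2)] assms(3)]
    by (auto simp: build_def is_above_def valid_def board_def)
next
  assume "c j \<le> i"
  moreover have "(c j, j) \<in> build n r c D"
    using assms(3) top_end_in_build[OF assms(2)] by (auto simp: board_def)
  ultimately show "(i, j) \<in> Col n (build n r c D)"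
    unfolding Col_iff[OF fb_tableau_build[OF assms(1,2)] assms(3)] is_above_def
    by (metis fst_conv snd_conv le_neq_implies_less)
qed

text \<open>The triple consists of the leftmost cell of each row, which has the greatest label, the
  topmost cell of each column, and \<open>T\<close> itself as set of dots. Root and border ensure
  that no row or column is empty. Validity is the support condition at the ends: a leftmost cell
  other than the root can only be supported from above, a topmost one only from the left.\<close>

lemma fb_tableau_eq_build:
  assumes "n > 0" "fb_tableau n T"
  obtains r c where "valid n r c" "T = build n r c T"
proof -
  define r where "r i = (GREATEST j. (i, j) \<in> T)" for i
  define c where "c j = (LEAST i. (i, j) \<in> T)" for j
  have sub: "1 \<le> i \<and> i \<le> n \<and> 1 \<le> j \<and> i - 1 \<le> j \<and> j \<le> n" if "(i, j) \<in> T" for i j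
    using assms(2) that by (auto simp: fb_tableau_def board_def)
  have root: "(1, n) \<in> T" using assms(2) by (auto simp: fb_tableau_def root_def)
  have border: "(i, i - 1) \<in> T" if "2 \<le> i" "i \<le> n" for i
    using assms(2) that by (auto simp: fb_tableau_def border_def)
  have support: "(\<exists>k > j. (i, k) \<in> T) \<or> (\<exists>k < i. (k, j) \<in> T)" if "(i, j) \<in> T" "(i, j) \<noteq> (1, n)" for i j
  proof -
    have "(i, j) \<in> T - {root n}" using that by (auto simp: root_def)
    with assms(2) obtain d where "d \<in> T" "is_left_of d (i, j) \<or> is_above d (i, j)"
      unfolding fb_tableau_def by blast
    then show ?thesis by (cases d) (auto simp: is_left_of_def is_above_def)
  qed
  have le_r: "j \<le> r i" if "(i, j) \<in> T" for i j
    unfolding r_def using that by (rule Greatest_le_nat[of _ _ n]) (use sub in blast)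
  have c_le: "c j \<le> i" if "(i, j) \<in> T" for i j
    unfolding c_def using that by (rule Least_le)
  have rT: "(i, r i) \<in> T" if "(i, j) \<in> T" for i j
    unfolding r_def using that by (rule GreatestI_nat[of _ _ n]) (use sub in blast)
  have cT: "(c j, j) \<in> T" if "(i, j) \<in> T" for i j
    unfolding c_def using that by (rule LeastI)
  have v: "valid n r c"
    unfolding valid_def
  proof (intro conjI allI impI)
    show "r 1 = n" using sub[OF rT[OF root]] le_r[OF root] by auto
    show "c n = 1" using sub[OF cT[OF root]] c_le[OF root] by auto
  next
    fix i assume i: "2 \<le> i \<and> i \<le> n"
    then have b: "(i, i - 1) \<in> T" using border by blast
    show "i - 1 \<le> r i" using le_r[OF b] .
    show "r i \<le> n" using sub[OF rT[OF b]] by auto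
    from support[OF rT[OF b]] i le_r obtain k where "k < i" "(k, r i) \<in> T"
      by (metis One_nat_def Pair_inject Suc_1 not_less not_less_eq_eq order_refl)
    then show "c (r i) < i" using c_le le_less_trans by blast
  next
    fix j assume j: "1 \<le> j \<and> j < n"
    then have b: "(j + 1, j) \<in> T" using border[of "j + 1"] by auto
    show "1 \<le> c j" using sub[OF cT[OF b]] by auto
    show "c j \<le> j + 1" using c_le[OF b] .
    from support[OF cT[OF b]] j c_le obtain k where "k > j" "(c j, k) \<in> T"
      by (metis Pair_inject not_less order_less_irrefl)
    then show "j < r (c j)" using le_r less_le_trans by blast
  qed
  have "(i, j) \<in> T \<longleftrightarrow> (i, j) \<in> build n r c T" for i j
  proof
    assume "(i, j) \<in> T"
    then show "(i, j) \<in> build n r c T"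
      using sub[of i j] le_r[of i j] c_le[of i j] by (auto simp: build_def board_def)
  next
    assume a: "(i, j) \<in> build n r c T"
    then have b: "1 \<le> i" "i \<le> n" "1 \<le> j" "i - 1 \<le> j" "j \<le> n" "c j \<le> i" "j \<le> r i"
      by (auto simp: build_def board_def)
    have "\<exists>k. (i, k) \<in> T"
      using root border[of i] b by (cases "i = 1") auto
    then have 1: "(i, r i) \<in> T" using rT by blast
    have "\<exists>k. (k, j) \<in> T"
      using root border[of "j + 1"] b by (cases "j = n") auto
    then have 2: "(c j, j) \<in> T" using cT by blast
    \<comment> \<open>Ends of rows and columns lie in \<open>T\<close>; a cell strictly beyond both
      ends is governed by membership in \<open>T\<close>, except for border cells, which are always
      nonempty.\<close>
    consider "c j = i" | "j = r i" | "c j < i" "j < r i" "i \<le> j" | "i = j + 1" using b by linarith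
    then show "(i, j) \<in> T"
    proof cases
      case 3
      then show ?thesis using a by (auto simp: build_def)
    next
      case 4
      then show ?thesis using border[of i] b by auto
    qed (use 1 2 in auto)
  qed
  then have "T = build n r c T" by auto
  with v that show thesis by blast
qed

section \<open>Tableaux as sets ordered by inclusion\<close>

text \<open>The Boolean decides whether a cell with forbidden cohook counts as having ceased to be free.\<close>

definition enc :: "bool \<Rightarrow> nat \<Rightarrow> cell set \<Rightarrow> (nat \<times> cell) set" where
  "enc b n T = {0} \<times> Col n T \<union> {1} \<times> (board n - Row n T) \<union>
     {2} \<times> {(i, j). 2 \<le> i \<and> i \<le> j \<and> j < n \<and>
       (if (i - 1, j) \<in> Col n T then (i, j + 1) \<in> Row n T \<longrightarrow> (i, j) \<in> T
        else (i, j + 1) \<notin> Row n T \<and> b)}"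

lemma enc_subset: "enc b n T \<subseteq> {0, 1, 2} \<times> board n"
  by (auto simp: enc_def Col_def board_def)

lemma finite_enc: "finite (enc b n T)"
  using enc_subset by (rule finite_subset) (simp add: finite_board)

lemma dot_iff_mem_of_free:
  assumes "fb_tableau n T" "free n T c"
  shows "dot n T c \<longleftrightarrow> c \<in> T"
proof -
  have b: "c \<in> board n" using assms(2) by (simp add: free_def)
  then have "c \<noteq> root n" using assms free_iff[OF assms(1) b] by (auto simp: root_def)
  then show ?thesis using mem_fb_tableau_iff[OF assms(1) b] assms(2) by (auto simp: dot_def)
qed

text \<open>Tags 0 and 1 are the two inclusions. Climbing enlarges \<open>Col\<close> and shrinks
  \<open>Row\<close>, so a cell is free between the entry of \<open>(i - 1, j)\<close> into
  \<open>Col\<close> and the departure of \<open>(i, j + 1)\<close> from \<open>Row\<close>; tag 2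
  says that it holds a dot or that this period is over. If the departure precedes the entry, the
  cell may be counted either way in the meantime without spoiling monotonicity, which is why both
  Booleans work.\<close>

lemma fb_le_iff_enc:
  assumes S: "fb_tableau n S" and T: "fb_tableau n T"
  shows "fb_le n S T \<longleftrightarrow> enc b n S \<subseteq> enc b n T"
proof
  assume le: "fb_le n S T"
  then have RC: "Col n S \<subseteq> Col n T" "Row n T \<subseteq> Row n S" by (auto simp: fb_le_def)
  \<comment> \<open>The one case of tag 2 that depends on contents: by the inclusions the cell is
    free in both tableaux, so the order preserves its dot.\<close>
  have mem: "(i, j) \<in> T"
    if "2 \<le> i" "i \<le> j" "j < n" "(i - 1, j) \<in> Col n S" "(i, j + 1) \<in> Row n T" "(i, j) \<in> S" for i j
  proof -
    have bd: "(i, j) \<in> board n" using that by (auto simp: board_def)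
    have "free n S (i, j)" "free n T (i, j)"
      using that RC unfolding free_iff_Row_Col[OF S bd] free_iff_Row_Col[OF T bd] by auto
    then show ?thesis
      using le that(6) dot_iff_mem_of_free[OF S] dot_iff_mem_of_free[OF T] unfolding fb_le_def by blast
  qed
  then show "enc b n S \<subseteq> enc b n T" using RC unfolding enc_def by (auto split: if_splits)
next
  assume le: "enc b n S \<subseteq> enc b n T"
  have C: "Col n S \<subseteq> Col n T"
  proof
    fix x assume "x \<in> Col n S"
    then have "(0, x) \<in> enc b n S" by (simp add: enc_def)
    then have "(0, x) \<in> enc b n T" using le by blast
    then show "x \<in> Col n T" by (simp add: enc_def)
  qed
  have R: "Row n T \<subseteq> Row n S"
  proof
    fix x assume x: "x \<in> Row n T"
    then have "(1, x) \<notin> enc b n T" by (simp add: enc_def)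
    then have "(1, x) \<notin> enc b n S" using le by blast
    then show "x \<in> Row n S" using x by (simp add: enc_def Row_def)
  qed
  have "dot n T x" if x: "free n S x \<and> free n T x \<and> dot n S x" for x
  proof -
    obtain i j where ij: "x = (i, j)" by (cases x)
    have bd: "(i, j) \<in> board n" using x ij by (auto simp: free_def)
    have f: "i \<noteq> 1" "j \<noteq> n" "(i - 1, j) \<in> Col n S" "(i, j + 1) \<in> Row n T" "(i - 1, j) \<in> Col n T"
      using x free_iff_Row_Col[OF S bd] free_iff_Row_Col[OF T bd] ij by auto
    have "(i, j) \<in> T"
    proof (cases "i \<le> j")
      case True
      with f bd x ij dot_iff_mem_of_free[OF S] have "(2, (i, j)) \<in> enc b n S"
        by (auto simp: enc_def board_def)
      then have "(2, (i, j)) \<in> enc b n T" using le by blast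
      then show ?thesis using f by (simp add: enc_def)
    next
      \<comment> \<open>On the board, \<open>i > j\<close> forces \<open>i = j + 1\<close>, a border
        cell.\<close>
      case False
      with bd f have "(i, j) \<in> border n" by (auto simp: border_def board_def)
      then show ?thesis using T by (auto simp: fb_tableau_def)
    qed
    then show ?thesis using dot_iff_mem_of_free[OF T] x ij by blast
  qed
  with C R show "fb_le n S T" by (auto simp: fb_le_def)
qed

section \<open>Ranks along chains of nested records\<close>

lemma esTam_iff_enc:
  "(S, T) \<in> esTam n \<longleftrightarrow> fb_tableau n S \<and> fb_tableau n T \<and> enc b n S \<subseteq> enc b n T"
  using fb_le_iff_enc[of n S T b] by (auto simp: esTam_def)

lemma enc_inj:
  assumes "fb_tableau n S" "fb_tableau n T" "enc b n S = enc b n T"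
  shows "S = T"
  using assms partial_order_esTam[of n] esTam_iff_enc[of S T n b] esTam_iff_enc[of T S n b]
  unfolding partial_order_on_def antisym_def by blast

text \<open>Distinct comparable tableaux have strictly nested finite records. Since the right-hand
  side does not mention \<open>b\<close>, both ranks order a chain in the same way.\<close>

lemma card_enc_less_iff:
  assumes "C \<in> Chains (esTam n)" "S \<in> C" "T \<in> C"
  shows "card (enc b n S) < card (enc b n T) \<longleftrightarrow> (S, T) \<in> esTam n \<and> S \<noteq> T"
proof -
  have SC: "(S, T) \<in> esTam n \<or> (T, S) \<in> esTam n" using assms by (auto simp: Chains_def)
  have less: "card (enc b n X) < card (enc b n Y)" if "(X, Y) \<in> esTam n" "X \<noteq> Y" for X Y
    using that enc_inj esTam_iff_enc[of X Y n b]
    by (intro psubset_card_mono finite_enc) blast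
  show ?thesis
  proof (cases "S = T")
    case False
    show ?thesis
    proof
      assume "card (enc b n S) < card (enc b n T)"
      with False less[of T S] SC show "(S, T) \<in> esTam n \<and> S \<noteq> T" by auto
    qed (use less in blast)
  qed simp
qed

lemma card_enc_inj_on:
  assumes "C \<in> Chains (esTam n)"
  shows "inj_on (\<lambda>T. card (enc b n T)) C"
proof (rule inj_onI)
  fix S T assume ST: "S \<in> C" "T \<in> C" "card (enc b n S) = card (enc b n T)"
  moreover have "(S, T) \<in> esTam n \<or> (T, S) \<in> esTam n" using assms ST by (auto simp: Chains_def)
  ultimately show "S = T"
    using card_enc_less_iff[OF assms, of S T b] card_enc_less_iff[OF assms, of T S b]
    by auto
qed

lemma Chains_esTam_iff:
  "C \<in> Chains (esTam n) \<longleftrightarrow> (\<forall>S \<in> C. fb_tableau n S) \<and>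
     (\<forall>S \<in> C. \<forall>T \<in> C. enc b n S \<subseteq> enc b n T \<or> enc b n T \<subseteq> enc b n S)"
  unfolding Chains_def mem_Collect_eq esTam_iff_enc[of _ _ n b] by blast

section \<open>Single steps between tableaux without forbidden cohooks\<close>

text \<open>The two arms of a cohook are what membership in \<open>Row\<close> and
  \<open>Col\<close> tests. Row 1 and column \<open>n\<close> belong to \<open>Row\<close> and
  \<open>Col\<close> by default; there the root lies in the cohook.\<close>

lemma contains_forbidden_cohook_iff:
  assumes "fb_tableau n T"
  shows "contains_forbidden_cohook n T \<longleftrightarrow> \<not> board n \<subseteq> Row n T \<union> Col n T"
proof -
  have root: "root n \<in> T" using assms by (simp add: fb_tableau_def)
  have sub: "T \<subseteq> board n" using assms by (simp add: fb_tableau_def)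
  have "cohook n x \<inter> T = {} \<longleftrightarrow> x \<notin> Row n T \<union> Col n T" if x: "x \<in> board n" for x
  proof
    assume e: "cohook n x \<inter> T = {}"
    then have none: "\<not> (\<exists>d \<in> T. d = x \<or> is_left_of d x \<or> is_above d x)"
      using sub by (auto simp: cohook_def)
    have "fst x \<noteq> 1" "snd x \<noteq> n"
      using none root x by (auto simp: root_def is_left_of_def is_above_def board_def)
    then show "x \<notin> Row n T \<union> Col n T"
      using none Row_iff[OF assms x] Col_iff[OF assms x] by blast
  next
    assume "x \<notin> Row n T \<union> Col n T"
    then show "cohook n x \<inter> T = {}"
      using Row_iff[OF assms x] Col_iff[OF assms x] by (auto simp: cohook_def)
  qed
  then show ?thesis unfolding contains_forbidden_cohook_def by blast
qed

lemma forbidden_cohook_iff_build: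
  assumes "n > 0" "valid n r c"
  shows "contains_forbidden_cohook n (build n r c D) \<longleftrightarrow>
    (\<exists>i j. (i, j) \<in> board n \<and> r i < j \<and> i < c j)"
  unfolding contains_forbidden_cohook_iff[OF fb_tableau_build[OF assms]] subset_iff Un_iff split_paired_All
  using Row_build[OF assms] Col_build[OF assms] by (metis not_le)

section \<open>Records of built tableaux as inequalities\<close>

lemma enc_build:
  assumes "n > 0" "valid n r c"
  shows "(0, (i, j)) \<in> enc b n (build n r c D) \<longleftrightarrow> (i, j) \<in> board n \<and> c j \<le> i"
    and "(1, (i, j)) \<in> enc b n (build n r c D) \<longleftrightarrow> (i, j) \<in> board n \<and> r i < j"
    and "(2, (i, j)) \<in> enc b n (build n r c D) \<longleftrightarrow> 2 \<le> i \<and> i \<le> j \<and> j < n \<and>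
      (if c j < i then j < r i \<longrightarrow> (i, j) \<in> D else r i \<le> j \<and> b)"
proof -
  have C: "(i, j) \<in> Col n (build n r c D) \<longleftrightarrow> (i, j) \<in> board n \<and> c j \<le> i"
    using Col_build[OF assms, of i j D] by (auto simp: Col_def)
  have R: "(i, j) \<in> board n \<Longrightarrow> (i, j) \<in> Row n (build n r c D) \<longleftrightarrow> j \<le> r i"
    using Row_build[OF assms] .
  have in2: "(if (i - 1, j) \<in> Col n (build n r c D)
        then (i, j + 1) \<in> Row n (build n r c D) \<longrightarrow> (i, j) \<in> build n r c D
        else (i, j + 1) \<notin> Row n (build n r c D) \<and> b) \<longleftrightarrow>
      (if c j < i then j < r i \<longrightarrow> (i, j) \<in> D else r i \<le> j \<and> b)"
    if "2 \<le> i" "i \<le> j" "j < n"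
  proof -
    have bd: "(i - 1, j) \<in> board n" "(i, j + 1) \<in> board n" "(i, j) \<in> board n"
      using that by (auto simp: board_def)
    have "c j \<le> i - 1 \<longleftrightarrow> c j < i" using that by auto
    moreover have "j + 1 \<le> r i \<longleftrightarrow> j < r i" by auto
    moreover have "(i, j) \<in> build n r c D \<longleftrightarrow> c j \<le> i \<and> j \<le> r i \<and> (c j < i \<and> j < r i \<longrightarrow> (i, j) \<in> D)"
      using bd(3) that by (auto simp: build_def)
    ultimately show ?thesis
      unfolding Col_build[OF assms bd(1)] Row_build[OF assms bd(2)] by auto
  qed
  show "(0, (i, j)) \<in> enc b n (build n r c D) \<longleftrightarrow> (i, j) \<in> board n \<and> c j \<le> i"
    using C by (simp add: enc_def)
  show "(1, (i, j)) \<in> enc b n (build n r c D) \<longleftrightarrow> (i, j) \<in> board n \<and> r i < j"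
    using R by (auto simp: enc_def)
  show "(2, (i, j)) \<in> enc b n (build n r c D) \<longleftrightarrow> 2 \<le> i \<and> i \<le> j \<and> j < n \<and>
      (if c j < i then j < r i \<longrightarrow> (i, j) \<in> D else r i \<le> j \<and> b)"
    using in2 by (simp add: enc_def del: if_split cong: conj_cong)
qed

lemma enc_subsetI:
  assumes "\<And>i j. (0, (i, j)) \<in> enc b n S \<Longrightarrow> (0, (i, j)) \<in> A"
    and "\<And>i j. (1, (i, j)) \<in> enc b n S \<Longrightarrow> (1, (i, j)) \<in> A"
    and "\<And>i j. (2, (i, j)) \<in> enc b n S \<Longrightarrow> (2, (i, j)) \<in> A"
  shows "enc b n S \<subseteq> A"
proof
  fix x assume x: "x \<in> enc b n S"
  obtain k i j where kij: "x = (k, (i, j))" by (metis prod.exhaust)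
  with x have "k = 0 \<or> k = 1 \<or> k = 2" using enc_subset by fastforce
  with x kij assms show "x \<in> A" by blast
qed

lemma enc_eq_insertI:
  assumes "\<And>i j. (0, (i, j)) \<in> enc b n S \<longleftrightarrow> (0, (i, j)) = e \<or> (0, (i, j)) \<in> enc b n T"
    and "\<And>i j. (1, (i, j)) \<in> enc b n S \<longleftrightarrow> (1, (i, j)) = e \<or> (1, (i, j)) \<in> enc b n T"
    and "\<And>i j. (2, (i, j)) \<in> enc b n S \<longleftrightarrow> (2, (i, j)) = e \<or> (2, (i, j)) \<in> enc b n T"
    and "e \<in> enc b n S"
  shows "enc b n S = insert e (enc b n T)"
proof
  show "enc b n S \<subseteq> insert e (enc b n T)" by (rule enc_subsetI) (use assms(1-3) in auto)
  have "enc b n T \<subseteq> enc b n S" by (rule enc_subsetI) (use assms(1-3) in auto)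
  then show "insert e (enc b n T) \<subseteq> enc b n S" using assms(4) by blast
qed

section \<open>Moves on triples that change the record by one element\<close>

lemma valid_D:
  assumes "valid n r c"
  shows "r (Suc 0) = n" "c n = Suc 0"
    "2 \<le> i \<Longrightarrow> i \<le> n \<Longrightarrow> i - 1 \<le> r i" "2 \<le> i \<Longrightarrow> i \<le> n \<Longrightarrow> r i \<le> n" "2 \<le> i \<Longrightarrow> i \<le> n \<Longrightarrow> c (r i) < i"
    "1 \<le> j \<Longrightarrow> j < n \<Longrightarrow> 1 \<le> c j" "1 \<le> j \<Longrightarrow> j < n \<Longrightarrow> c j \<le> j + 1" "1 \<le> j \<Longrightarrow> j < n \<Longrightarrow> j < r (c j)"
  using assms by (auto simp: valid_def)

text \<open>Moves are tried in a fixed order: raise an up-arrow; once all are in row 1, put a dot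
  into an empty free cell; once none is left, push a left-arrow to the right. This avoids forbidden
  cohooks: raising an up-arrow only enlarges \<open>Col\<close>, and left-arrows move only when
  \<open>Col\<close> is the whole board.\<close>

lemma step_up_build:
  assumes n: "n > 0" and v: "valid n r c" and g: "\<And>i j. (i, j) \<in> board n \<Longrightarrow> j \<le> r i \<or> c j \<le> i"
  shows "(\<forall>i. 2 \<le> i \<and> i \<le> n \<longrightarrow> r i = i - 1) \<and> (\<forall>j. 1 \<le> j \<and> j < n \<longrightarrow> c j = 1) \<or>
    (\<exists>r' c' D' e. valid n r' c' \<and> (\<forall>i j. (i, j) \<in> board n \<longrightarrow> j \<le> r' i \<or> c' j \<le> i) \<and>
       (\<forall>b. e \<notin> enc b n (build n r c D) \<and>
         enc b n (build n r' c' D') = insert e (enc b n (build n r c D))))"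
proof -
  consider (col) j where "1 \<le> j" "j < n" "1 < c j"
    | (fill) i j where "\<And>j. 1 \<le> j \<Longrightarrow> j < n \<Longrightarrow> c j = 1" "2 \<le> i" "i \<le> j" "j < r i" "j < n" "(i, j) \<notin> D"
    | (row) i where "\<And>j. 1 \<le> j \<Longrightarrow> j < n \<Longrightarrow> c j = 1" "2 \<le> i" "i \<le> n" "i \<le> r i"
        "\<And>j. i \<le> j \<Longrightarrow> j < r i \<Longrightarrow> j < n \<Longrightarrow> (i, j) \<in> D"
    | (top) "\<And>j. 1 \<le> j \<Longrightarrow> j < n \<Longrightarrow> c j = 1" "\<And>i. 2 \<le> i \<Longrightarrow> i \<le> n \<Longrightarrow> r i < i"
  proof (cases "\<exists>j. 1 \<le> j \<and> j < n \<and> 1 < c j")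
    case True
    then show thesis using that(1) by blast
  next
    case False
    have c1: "c j = 1" if "1 \<le> j" "j < n" for j
      using False that valid_D(6)[OF v, of j] by (meson le_antisym not_less)
    show thesis
    proof (cases "\<exists>i j. 2 \<le> i \<and> i \<le> j \<and> j < r i \<and> j < n \<and> (i, j) \<notin> D")
      case True
      then show thesis using that(2)[OF c1] by blast
    next
      case fill: False
      show thesis
      proof (cases "\<exists>i. 2 \<le> i \<and> i \<le> n \<and> i \<le> r i")
        case True
        then obtain i where i: "2 \<le> i" "i \<le> n" "i \<le> r i" by blast
        then show thesis using that(3)[OF c1 i] fill by blast
      next
        case False
        then have "r i < i" if "2 \<le> i" "i \<le> n" for i using that by (meson not_less)
        then show thesis using that(4)[OF c1] by blast
      qed
    qed
  qed
  then show ?thesis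
  proof cases
    case col
    let ?c = "c(j := c j - 1)"
    note vj = valid_D(6-8)[OF v col(1,2)]
    \<comment> \<open>The raised arrow needs support on its left. \<open>g\<close> excludes
      \<open>r (c j - 1) < j\<close>, and in case of equality \<open>valid\<close> would give
      \<open>c j < c j - 1\<close>.\<close>
    have "j < r (c j - 1)"
    proof (cases "c j = 2")
      case True
      then show ?thesis using col valid_D(1)[OF v] by simp
    next
      case False
      with col vj have i: "2 \<le> c j - 1" "c j - 1 \<le> n" "(c j - 1, j) \<in> board n"
        by (auto simp: board_def)
      have "j \<le> r (c j - 1)" using g[OF i(3)] col by auto
      moreover have "j \<noteq> r (c j - 1)" using valid_D(5)[OF v i(1,2)] by auto
      ultimately show ?thesis by simp
    qed
    then have v': "valid n r ?c"
      unfolding valid_def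
    proof (intro conjI allI impI)
      fix i assume "2 \<le> i \<and> i \<le> n"
      then show "?c (r i) < i" using valid_D(5)[OF v, of i] by auto
    qed (use v col vj in \<open>auto simp: valid_def\<close>)
    have b': "(c j - 1, j) \<in> board n" using col vj by (auto simp: board_def)
    have g': "\<forall>i j'. (i, j') \<in> board n \<longrightarrow> j' \<le> r i \<or> ?c j' \<le> i"
    proof (intro allI impI)
      fix i j' assume "(i, j') \<in> board n"
      from g[OF this] show "j' \<le> r i \<or> ?c j' \<le> i" by auto
    qed
    have "(0, (c j - 1, j)) \<notin> enc b n (build n r c D)" for b
      using col unfolding enc_build[OF n v] by auto
    \<comment> \<open>The former arrow position becomes free. Off the border, deleting it from
      \<open>D\<close> makes it empty, so that no tag 2 is gained along with tag 0.\<close>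
    moreover have "enc b n (build n r ?c (D - {(c j, j)})) =
        insert (0, (c j - 1, j)) (enc b n (build n r c D))" for b
    proof (rule enc_eq_insertI, unfold enc_build[OF n v] enc_build[OF n v'])
      fix i j'
      have *: "c j - 1 \<le> i \<longleftrightarrow> i = c j - 1 \<or> c j \<le> i" "c j - 1 < i \<longleftrightarrow> i = c j \<or> c j < i"
        using col by auto
      show "(i, j') \<in> board n \<and> ?c j' \<le> i \<longleftrightarrow>
          (0 :: nat, i, j') = (0, c j - 1, j) \<or> (i, j') \<in> board n \<and> c j' \<le> i"
        using b' * by (cases "j' = j") auto
      show "(2 \<le> i \<and> i \<le> j' \<and> j' < n \<and>
          (if ?c j' < i then j' < r i \<longrightarrow> (i, j') \<in> D - {(c j, j)} else r i \<le> j' \<and> b)) \<longleftrightarrow>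
        (2 :: nat, i, j') = (0, c j - 1, j) \<or> 2 \<le> i \<and> i \<le> j' \<and> j' < n \<and>
          (if c j' < i then j' < r i \<longrightarrow> (i, j') \<in> D else r i \<le> j' \<and> b)"
        using * vj(3) by (cases "j' = j"; cases "i = c j") auto
    qed (use b' in auto)
    ultimately show ?thesis using v' g' by blast
  next
    case fill
    have "(2, (i, j)) \<notin> enc b n (build n r c D)" for b
      using fill unfolding enc_build[OF n v] by auto
    moreover have "enc b n (build n r c (insert (i, j) D)) =
        insert (2, (i, j)) (enc b n (build n r c D))" for b
      by (rule enc_eq_insertI; unfold enc_build[OF n v]) (use fill(2-) fill(1)[of j] in auto)
    ultimately show ?thesis using v g by blast
  next
    case row
    let ?r = "r(i := r i - 1)"
    note vi = valid_D(3-5)[OF v row(2,3)]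
    have cr: "c (r i - 1) < i" using row(1)[of "r i - 1"] row(2-4) vi(2) by auto
    have v': "valid n ?r c"
      unfolding valid_def
    proof (intro conjI allI impI)
      fix j assume j: "1 \<le> j \<and> j < n"
      then show "j < ?r (c j)" using row(1)[of j] valid_D(1)[OF v] row(2) by auto
    qed (use v row(2-4) vi cr in \<open>auto simp: valid_def\<close>)
    have b': "(i, r i) \<in> board n" using row(2-4) vi by (auto simp: board_def)
    have c1: "c j = 1" if "(i', j) \<in> board n" for i' j
      using row(1)[of j] that valid_D(2)[OF v] by (cases "j = n") (auto simp: board_def)
    have g': "\<forall>i' j. (i', j) \<in> board n \<longrightarrow> j \<le> ?r i' \<or> c j \<le> i'"
      using c1 by (auto simp: board_def)
    have "(1, (i, r i)) \<notin> enc b n (build n r c D)" for b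
      unfolding enc_build[OF n v] by auto
    \<comment> \<open>The cell \<open>(i, r i - 1)\<close> ceases to be free; off the border it
      already carries a dot, since row \<open>i\<close> has no empty free cell left, so tag 2 is
      unchanged.\<close>
    moreover have "enc b n (build n ?r c D) =
        insert (1, (i, r i)) (enc b n (build n r c D))" for b
    proof (rule enc_eq_insertI, unfold enc_build[OF n v] enc_build[OF n v'])
      fix i' j
      show "(i', j) \<in> board n \<and> ?r i' < j \<longleftrightarrow>
          (1 :: nat, i', j) = (1, i, r i) \<or> (i', j) \<in> board n \<and> r i' < j"
        using b' row(2,4) by (cases "i' = i") auto
      show "(2 \<le> i' \<and> i' \<le> j \<and> j < n \<and>
          (if c j < i' then j < ?r i' \<longrightarrow> (i', j) \<in> D else ?r i' \<le> j \<and> b)) \<longleftrightarrow>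
        (2 :: nat, i', j) = (1, i, r i) \<or> 2 \<le> i' \<and> i' \<le> j \<and> j < n \<and>
          (if c j < i' then j < r i' \<longrightarrow> (i', j) \<in> D else r i' \<le> j \<and> b)"
        using row(1)[of j] row(5)[of j] by (cases "i' = i") auto
    qed (use b' row(2-4) in auto)
    ultimately show ?thesis using v' g' by blast
  next
    case top
    have "r i = i - 1" if "2 \<le> i" "i \<le> n" for i
      using top(2)[OF that] valid_D(3)[OF v that] by simp
    with top(1) show ?thesis by blast
  qed
qed

text \<open>The reverse order of moves: shift a left-arrow to the left; once all are in column
  \<open>n\<close>, erase a dot off the border; once none is left, lower an up-arrow.
  \<open>Row\<close> grows in the first move and is the whole board before the last one begins, so
  no forbidden cohook arises.\<close>

lemma step_down_build:
  assumes n: "n > 0" and v: "valid n r c" and g: "\<And>i j. (i, j) \<in> board n \<Longrightarrow> j \<le> r i \<or> c j \<le> i"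
  shows "(\<forall>i. 2 \<le> i \<and> i \<le> n \<longrightarrow> r i = n) \<and> (\<forall>j. 1 \<le> j \<and> j < n \<longrightarrow> c j = j + 1) \<or>
    (\<exists>r' c' D' e. valid n r' c' \<and> (\<forall>i j. (i, j) \<in> board n \<longrightarrow> j \<le> r' i \<or> c' j \<le> i) \<and>
       (\<forall>b. e \<notin> enc b n (build n r' c' D') \<and>
         enc b n (build n r c D) = insert e (enc b n (build n r' c' D'))))"
proof -
  consider (row) i where "2 \<le> i" "i \<le> n" "r i < n"
    | (empty) i j where "\<And>i. 2 \<le> i \<Longrightarrow> i \<le> n \<Longrightarrow> r i = n" "2 \<le> i" "i \<le> j" "c j < i" "j < n" "(i, j) \<in> D"
    | (col) j where "\<And>i. 2 \<le> i \<Longrightarrow> i \<le> n \<Longrightarrow> r i = n" "1 \<le> j" "j < n" "c j \<le> j"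
        "\<And>i. 2 \<le> i \<Longrightarrow> c j < i \<Longrightarrow> i \<le> j \<Longrightarrow> (i, j) \<notin> D"
    | (bot) "\<And>i. 2 \<le> i \<Longrightarrow> i \<le> n \<Longrightarrow> r i = n" "\<And>j. 1 \<le> j \<Longrightarrow> j < n \<Longrightarrow> j < c j"
  proof (cases "\<exists>i. 2 \<le> i \<and> i \<le> n \<and> r i < n")
    case True
    then show thesis using that(1) by blast
  next
    case False
    have rn: "r i = n" if "2 \<le> i" "i \<le> n" for i
      using False that valid_D(4)[OF v, of i] by (meson le_antisym not_less)
    show thesis
    proof (cases "\<exists>i j. 2 \<le> i \<and> i \<le> j \<and> c j < i \<and> j < n \<and> (i, j) \<in> D")
      case True
      then show thesis using that(2)[OF rn] by blast
    next
      case empty: False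
      show thesis
      proof (cases "\<exists>j. 1 \<le> j \<and> j < n \<and> c j \<le> j")
        case True
        then obtain j where j: "1 \<le> j" "j < n" "c j \<le> j" by blast
        then show thesis using that(3)[OF rn j] empty by blast
      next
        case False
        then have "j < c j" if "1 \<le> j" "j < n" for j using that by (meson not_less)
        then show thesis using that(4)[OF rn] by blast
      qed
    qed
  qed
  then show ?thesis
  proof cases
    case row
    let ?r = "r(i := r i + 1)"
    note vi = valid_D(3-5)[OF v row(1,2)]
    have b': "(i, r i + 1) \<in> board n" using row vi by (auto simp: board_def)
    \<comment> \<open>The shifted arrow needs support from above. \<open>g\<close> gives
      \<open>c (r i + 1) \<le> i\<close>, and in case of equality \<open>valid\<close> would give
      \<open>r i + 1 < r i\<close>.\<close>
    have cr: "c (r i + 1) < i"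
    proof (cases "r i + 1 = n")
      case True
      then show ?thesis using row valid_D(2)[OF v] by simp
    next
      case False
      with row have j: "1 \<le> r i + 1" "r i + 1 < n" by auto
      have "c (r i + 1) \<le> i" using g[OF b'] by auto
      moreover have "c (r i + 1) \<noteq> i" using valid_D(8)[OF v j] by auto
      ultimately show ?thesis by simp
    qed
    then have v': "valid n ?r c"
      unfolding valid_def
    proof (intro conjI allI impI)
      fix j assume "1 \<le> j \<and> j < n"
      then show "j < ?r (c j)" using valid_D(8)[OF v, of j] by auto
    qed (use v row vi in \<open>auto simp: valid_def\<close>)
    have g': "\<forall>i' j'. (i', j') \<in> board n \<longrightarrow> j' \<le> ?r i' \<or> c j' \<le> i'"
    proof (intro allI impI)
      fix i' j' assume "(i', j') \<in> board n"
      from g[OF this] show "j' \<le> ?r i' \<or> c j' \<le> i'" by auto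
    qed
    have "(1, (i, r i + 1)) \<notin> enc b n (build n ?r c (insert (i, r i) D))" for b
      unfolding enc_build[OF n v'] by auto
    \<comment> \<open>The former left-arrow at \<open>(i, r i)\<close> becomes a free cell;
      inserting it into \<open>D\<close> makes it a dot, so tag 2 is unchanged.\<close>
    moreover have "enc b n (build n r c D) =
        insert (1, (i, r i + 1)) (enc b n (build n ?r c (insert (i, r i) D)))" for b
    proof (rule enc_eq_insertI, unfold enc_build[OF n v] enc_build[OF n v'])
      fix i' j
      show "(i', j) \<in> board n \<and> r i' < j \<longleftrightarrow>
          (1 :: nat, i', j) = (1, i, r i + 1) \<or> (i', j) \<in> board n \<and> ?r i' < j"
        using b' by (cases "i' = i") auto
      show "(2 \<le> i' \<and> i' \<le> j \<and> j < n \<and>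
          (if c j < i' then j < r i' \<longrightarrow> (i', j) \<in> D else r i' \<le> j \<and> b)) \<longleftrightarrow>
        (2 :: nat, i', j) = (1, i, r i + 1) \<or> 2 \<le> i' \<and> i' \<le> j \<and> j < n \<and>
          (if c j < i' then j < ?r i' \<longrightarrow> (i', j) \<in> insert (i, r i) D else ?r i' \<le> j \<and> b)"
        using vi(3) by (cases "i' = i"; cases "j = r i") auto
    qed (use b' in auto)
    ultimately show ?thesis using v' g' by blast
  next
    case empty
    have ri: "r i = n" using empty by auto
    have "(2, (i, j)) \<notin> enc b n (build n r c (D - {(i, j)}))" for b
      using empty(2-) ri unfolding enc_build[OF n v] by auto
    moreover have "enc b n (build n r c D) =
        insert (2, (i, j)) (enc b n (build n r c (D - {(i, j)})))" for b
      by (rule enc_eq_insertI; unfold enc_build[OF n v]) (use empty(2-) ri in auto)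
    ultimately show ?thesis using v g by blast
  next
    case col
    let ?c = "c(j := c j + 1)"
    note vj = valid_D(6-8)[OF v col(2,3)]
    have rc: "r (c j + 1) = n" using col(1)[of "c j + 1"] col(2-4) vj(1) by auto
    have v': "valid n r ?c"
      unfolding valid_def
    proof (intro conjI allI impI)
      fix i assume i: "2 \<le> i \<and> i \<le> n"
      then show "?c (r i) < i" using col(1)[of i] valid_D(2)[OF v] col(3) by auto
    qed (use v col(2-4) vj rc in \<open>auto simp: valid_def\<close>)
    have b': "(c j, j) \<in> board n" using col(2-4) vj by (auto simp: board_def)
    have r1: "r i = n" if "(i, j') \<in> board n" for i j'
      using col(1)[of i] that valid_D(1)[OF v] by (cases "i = 1") (auto simp: board_def)
    have g': "\<forall>i j'. (i, j') \<in> board n \<longrightarrow> j' \<le> r i \<or> ?c j' \<le> i"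
      using r1 by (auto simp: board_def)
    have "(0, (c j, j)) \<notin> enc b n (build n r ?c D)" for b
      unfolding enc_build[OF n v'] by auto
    \<comment> \<open>The cell \<open>(c j + 1, j)\<close> ceases to be free as the arrow drops onto
      it; off the border it is empty by the choice of this case, so tag 2 is unchanged.\<close>
    moreover have "enc b n (build n r c D) =
        insert (0, (c j, j)) (enc b n (build n r ?c D))" for b
    proof (rule enc_eq_insertI, unfold enc_build[OF n v] enc_build[OF n v'])
      fix i j'
      show "(i, j') \<in> board n \<and> c j' \<le> i \<longleftrightarrow>
          (0 :: nat, i, j') = (0, c j, j) \<or> (i, j') \<in> board n \<and> ?c j' \<le> i"
        using b' by (cases "j' = j") auto
      show "(2 \<le> i \<and> i \<le> j' \<and> j' < n \<and>
          (if c j' < i then j' < r i \<longrightarrow> (i, j') \<in> D else r i \<le> j' \<and> b)) \<longleftrightarrow>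
        (2 :: nat, i, j') = (0, c j, j) \<or> 2 \<le> i \<and> i \<le> j' \<and> j' < n \<and>
          (if ?c j' < i then j' < r i \<longrightarrow> (i, j') \<in> D else r i \<le> j' \<and> b)"
        using col(1)[of i] col(5)[of i] by (cases "j' = j") auto
    qed (use b' in auto)
    ultimately show ?thesis using v' g' by blast
  next
    case bot
    have "c j = j + 1" if "1 \<le> j" "j < n" for j
      using bot(2)[OF that] valid_D(7)[OF v that] by simp
    with bot(1) show ?thesis by blast
  qed
qed

text \<open>A triple without an upward move has the whole board as \<open>Col\<close>, the smallest
  possible \<open>Row\<close> and every tag 2, hence gives the greatest tableau.\<close>

lemma step_up:
  assumes n: "n > 0" and T: "fb_tableau n T" "\<not> contains_forbidden_cohook n T"
  shows "(\<forall>S. fb_tableau n S \<longrightarrow> (S, T) \<in> esTam n) \<or>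
    (\<exists>S e. fb_tableau n S \<and> \<not> contains_forbidden_cohook n S \<and>
       (\<forall>b. e \<notin> enc b n T \<and> enc b n S = insert e (enc b n T)))"
proof -
  obtain r c where rc: "valid n r c" "T = build n r c T" using fb_tableau_eq_build[OF n T(1)] .
  have g: "j \<le> r i \<or> c j \<le> i" if "(i, j) \<in> board n" for i j
    using T(2) that rc forbidden_cohook_iff_build[OF n rc(1), of T] by (metis not_le)
  from step_up_build[OF n rc(1) g, of T] show ?thesis
  proof
    assume top: "(\<forall>i. 2 \<le> i \<and> i \<le> n \<longrightarrow> r i = i - 1) \<and> (\<forall>j. 1 \<le> j \<and> j < n \<longrightarrow> c j = 1)"
    have "(S, T) \<in> esTam n" if S: "fb_tableau n S" for S
    proof -
      obtain r' c' where rc': "valid n r' c'" "S = build n r' c' S" using fb_tableau_eq_build[OF n S] .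
      have c1: "c j = 1" if "(i, j) \<in> board n" for i j
        using top that valid_D(2)[OF rc(1)] by (cases "j = n") (auto simp: board_def)
      have r1: "r i \<le> r' i" if "(i, j) \<in> board n" for i j
        using top that valid_D(1)[OF rc(1)] valid_D(1)[OF rc'(1)] valid_D(3)[OF rc'(1), of i]
        by (cases "i = 1") (auto simp: board_def)
      have "enc False n (build n r' c' S) \<subseteq> enc False n (build n r c T)"
      proof (rule enc_subsetI, unfold enc_build[OF n rc(1)] enc_build[OF n rc'(1)])
        fix i j
        show "(i, j) \<in> board n \<and> c' j \<le> i \<Longrightarrow> (i, j) \<in> board n \<and> c j \<le> i"
          using c1[of i j] by (auto simp: board_def)
        show "(i, j) \<in> board n \<and> r' i < j \<Longrightarrow> (i, j) \<in> board n \<and> r i < j"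
          using r1[of i j] by auto
      qed (use top in auto)
      then have "enc False n S \<subseteq> enc False n T" using rc(2) rc'(2) by simp
      then show ?thesis using S T(1) esTam_iff_enc by blast
    qed
    then show ?thesis by blast
  next
    assume "\<exists>r' c' D' e. valid n r' c' \<and> (\<forall>i j. (i, j) \<in> board n \<longrightarrow> j \<le> r' i \<or> c' j \<le> i) \<and>
       (\<forall>b. e \<notin> enc b n (build n r c T) \<and>
         enc b n (build n r' c' D') = insert e (enc b n (build n r c T)))"
    then obtain r' c' D' e where s: "valid n r' c'" "\<forall>i j. (i, j) \<in> board n \<longrightarrow> j \<le> r' i \<or> c' j \<le> i"
       "\<forall>b. e \<notin> enc b n T \<and> enc b n (build n r' c' D') = insert e (enc b n T)"
      unfolding rc(2)[symmetric] by blast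
    then have "\<not> contains_forbidden_cohook n (build n r' c' D')"
      unfolding forbidden_cohook_iff_build[OF n s(1)] by (auto simp: not_less)
    then show ?thesis using s(3) fb_tableau_build[OF n s(1)] by blast
  qed
qed

text \<open>A triple without a downward move has the smallest possible \<open>Col\<close>, the whole
  board as \<open>Row\<close> and no tag 2, hence gives the least tableau.\<close>

lemma step_down:
  assumes n: "n > 0" and T: "fb_tableau n T" "\<not> contains_forbidden_cohook n T"
  shows "(\<forall>S. fb_tableau n S \<longrightarrow> (T, S) \<in> esTam n) \<or>
    (\<exists>S e. fb_tableau n S \<and> \<not> contains_forbidden_cohook n S \<and>
       (\<forall>b. e \<notin> enc b n S \<and> enc b n T = insert e (enc b n S)))"
proof -
  obtain r c where rc: "valid n r c" "T = build n r c T" using fb_tableau_eq_build[OF n T(1)] .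
  have g: "j \<le> r i \<or> c j \<le> i" if "(i, j) \<in> board n" for i j
    using T(2) that rc forbidden_cohook_iff_build[OF n rc(1), of T] by (metis not_le)
  from step_down_build[OF n rc(1) g, of T] show ?thesis
  proof
    assume bot: "(\<forall>i. 2 \<le> i \<and> i \<le> n \<longrightarrow> r i = n) \<and> (\<forall>j. 1 \<le> j \<and> j < n \<longrightarrow> c j = j + 1)"
    have "(T, S) \<in> esTam n" if S: "fb_tableau n S" for S
    proof -
      obtain r' c' where rc': "valid n r' c'" "S = build n r' c' S" using fb_tableau_eq_build[OF n S] .
      have c1: "c' j \<le> c j" if "(i, j) \<in> board n" for i j
        using bot that valid_D(2)[OF rc(1)] valid_D(2)[OF rc'(1)] valid_D(7)[OF rc'(1), of j]
        by (cases "j = n") (auto simp: board_def)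
      have r1: "r i = n" if "(i, j) \<in> board n" for i j
        using bot that valid_D(1)[OF rc(1)] by (cases "i = 1") (auto simp: board_def)
      have "enc False n (build n r c T) \<subseteq> enc False n (build n r' c' S)"
      proof (rule enc_subsetI, unfold enc_build[OF n rc(1)] enc_build[OF n rc'(1)])
        fix i j
        show "(i, j) \<in> board n \<and> c j \<le> i \<Longrightarrow> (i, j) \<in> board n \<and> c' j \<le> i"
          using c1[of i j] by auto
        show "(i, j) \<in> board n \<and> r i < j \<Longrightarrow> (i, j) \<in> board n \<and> r' i < j"
          using r1[of i j] by (auto simp: board_def)
      qed (use bot in \<open>auto split: if_splits\<close>)
      then have "enc False n T \<subseteq> enc False n S" using rc(2) rc'(2) by simp
      then show ?thesis using S T(1) esTam_iff_enc by blast
    qed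
    then show ?thesis by blast
  next
    assume "\<exists>r' c' D' e. valid n r' c' \<and> (\<forall>i j. (i, j) \<in> board n \<longrightarrow> j \<le> r' i \<or> c' j \<le> i) \<and>
       (\<forall>b. e \<notin> enc b n (build n r' c' D') \<and>
         enc b n (build n r c T) = insert e (enc b n (build n r' c' D')))"
    then obtain r' c' D' e where s: "valid n r' c'" "\<forall>i j. (i, j) \<in> board n \<longrightarrow> j \<le> r' i \<or> c' j \<le> i"
       "\<forall>b. e \<notin> enc b n (build n r' c' D') \<and> enc b n T = insert e (enc b n (build n r' c' D'))"
      unfolding rc(2)[symmetric] by blast
    then have "\<not> contains_forbidden_cohook n (build n r' c' D')"
      unfolding forbidden_cohook_iff_build[OF n s(1)] by (auto simp: not_less)
    then show ?thesis using s(3) fb_tableau_build[OF n s(1)] by blast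
  qed
qed

lemma exists_without_forbidden_cohook:
  assumes "n > 0"
  shows "\<exists>T. fb_tableau n T \<and> \<not> contains_forbidden_cohook n T"
proof -
  \<comment> \<open>The least tableau: left-arrows in column \<open>n\<close>, up-arrows on the
    border, the root as exception at \<open>j = n\<close>. Its \<open>Row\<close> is the whole
    board.\<close>
  have v: "valid n (\<lambda>i. n) (\<lambda>j. if j = n then 1 else j + 1)" by (auto simp: valid_def)
  have "\<not> contains_forbidden_cohook n (build n (\<lambda>i. n) (\<lambda>j. if j = n then 1 else j + 1) {})"
    unfolding forbidden_cohook_iff_build[OF assms v] by (auto simp: board_def)
  with fb_tableau_build[OF assms v] show ?thesis by blast
qed

section \<open>The spine\<close>

text \<open>A climb from \<open>T\<close> to the greatest element and a descent to the least one,
  glued at \<open>T\<close>, pass through every rank in between. The last equation says that the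
  chain has one element for each rank.\<close>

lemma long_chain_through:
  assumes n: "n > 0" and T: "fb_tableau n T" "\<not> contains_forbidden_cohook n T"
  obtains C bot top where "C \<in> Chains (esTam n)" "T \<in> C"
    "fb_tableau n bot" "\<not> contains_forbidden_cohook n bot" "\<forall>S. fb_tableau n S \<longrightarrow> (bot, S) \<in> esTam n"
    "fb_tableau n top" "\<not> contains_forbidden_cohook n top" "\<forall>S. fb_tableau n S \<longrightarrow> (S, top) \<in> esTam n"
    "card (enc False n bot) + card C = card (enc False n top) + 1"
proof -
  let ?G = "{T. fb_tableau n T \<and> \<not> contains_forbidden_cohook n T}"
  let ?E = "enc False n"
  have TG: "T \<in> ?G" using T by blast
  have fin: "finite ({0, 1, 2 :: nat} \<times> board n)" by (simp add: finite_board)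
  have up: "\<forall>x \<in> ?G. (\<forall>S. fb_tableau n S \<longrightarrow> (S, x) \<in> esTam n) \<or>
      (\<exists>y \<in> ?G. \<exists>e. e \<notin> ?E x \<and> ?E y = insert e (?E x))" (is "\<forall>x \<in> _. ?P x")
  proof
    fix x assume "x \<in> ?G"
    consider "\<forall>S. fb_tableau n S \<longrightarrow> (S, x) \<in> esTam n"
      | S e where "S \<in> ?G" "\<forall>b. e \<notin> enc b n x \<and> enc b n S = insert e (enc b n x)"
      using step_up[OF n] \<open>x \<in> ?G\<close> unfolding mem_Collect_eq by metis
    then show "?P x"
    proof cases
      case 2
      from 2(2) have "e \<notin> ?E x \<and> ?E S = insert e (?E x)" by (rule spec)
      with 2(1) show ?thesis by (intro disjI2 bexI exI)
    qed (rule disjI1)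
  qed
  have down: "\<forall>x \<in> ?G. (\<forall>S. fb_tableau n S \<longrightarrow> (x, S) \<in> esTam n) \<or>
      (\<exists>y \<in> ?G. \<exists>e. e \<notin> ?E y \<and> ?E x = insert e (?E y))" (is "\<forall>x \<in> _. ?P x")
  proof
    fix x assume "x \<in> ?G"
    consider "\<forall>S. fb_tableau n S \<longrightarrow> (x, S) \<in> esTam n"
      | S e where "S \<in> ?G" "\<forall>b. e \<notin> enc b n S \<and> enc b n x = insert e (enc b n S)"
      using step_down[OF n] \<open>x \<in> ?G\<close> unfolding mem_Collect_eq by metis
    then show "?P x"
    proof cases
      case 2
      from 2(2) have "e \<notin> ?E S \<and> ?E x = insert e (?E S)" by (rule spec)
      with 2(1) show ?thesis by (intro disjI2 bexI exI)
    qed (rule disjI1)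
  qed
  from saturated_chain_above[OF fin enc_subset up TG] obtain C1 top where
    C1: "C1 \<subseteq> ?G" "finite C1" "T \<in> C1" "top \<in> C1"
    "\<forall>S. fb_tableau n S \<longrightarrow> (S, top) \<in> esTam n" "\<forall>y \<in> C1. ?E T \<subseteq> ?E y"
    "\<forall>y \<in> C1. \<forall>z \<in> C1. ?E y \<subseteq> ?E z \<or> ?E z \<subseteq> ?E y" "card (?E T) + card C1 = card (?E top) + 1"
    by (elim exE conjE)
  from saturated_chain_below[OF finite_enc down TG] obtain C2 bot where
    C2: "C2 \<subseteq> ?G" "finite C2" "T \<in> C2" "bot \<in> C2"
    "\<forall>S. fb_tableau n S \<longrightarrow> (bot, S) \<in> esTam n" "\<forall>y \<in> C2. ?E y \<subseteq> ?E T"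
    "\<forall>y \<in> C2. \<forall>z \<in> C2. ?E y \<subseteq> ?E z \<or> ?E z \<subseteq> ?E y" "card (?E bot) + card C2 = card (?E T) + 1"
    by (elim exE conjE)
  \<comment> \<open>Records in \<open>C1\<close> contain that of \<open>T\<close> and records in
    \<open>C2\<close> are contained in it, so the chains overlap only in \<open>T\<close>, which is
    counted twice.\<close>
  have "S = T" if "S \<in> C1" "S \<in> C2" for S
  proof -
    have "?E S = ?E T" using that C1(6) C2(6) by blast
    moreover have "fb_tableau n S" using that C1(1) by blast
    ultimately show ?thesis using T(1) enc_inj by blast
  qed
  with C1(3) C2(3) have I: "C1 \<inter> C2 = {T}" by blast
  have "card (C1 \<union> C2) + 1 = card C1 + card C2"
    using card_Un_Int[OF C1(2) C2(2)] I by simp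
  then have card: "card (?E bot) + card (C1 \<union> C2) = card (?E top) + 1"
    using C1(8) C2(8) by simp
  have fb: "\<forall>S \<in> C1 \<union> C2. fb_tableau n S" using C1(1) C2(1) by blast
  have "\<forall>y \<in> C1. \<forall>z \<in> C2. ?E z \<subseteq> ?E y" using C1(6) C2(6) by blast
  then have "\<forall>y \<in> C1 \<union> C2. \<forall>z \<in> C1 \<union> C2. ?E y \<subseteq> ?E z \<or> ?E z \<subseteq> ?E y"
    using C1(7) C2(7) by blast
  with fb have "C1 \<union> C2 \<in> Chains (esTam n)" using Chains_esTam_iff[of _ n False] by blast
  then show thesis
    using that[of "C1 \<union> C2" bot top] C1 C2 card by blast
qed

section \<open>Forbidden cohooks as disagreement of the two ranks\<close>

lemma enc_False_subset_enc_True: "enc False n T \<subseteq> enc True n T"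
  by (auto simp: enc_def)

text \<open>The two records differ in tag 2 of the cells with \<open>i \<le> c j\<close> and
  \<open>r i \<le> j\<close>. Equality cannot occur: by \<open>valid\<close>, \<open>r i = j\<close>
  forces \<open>c j < i\<close>, and \<open>c j = i\<close> forces \<open>j < r i\<close>. What
  remains are the corners of forbidden cohooks.\<close>

lemma enc_ambiguous_iff:
  assumes n: "n > 0" and T: "fb_tableau n T"
  shows "card (enc False n T) = card (enc True n T) \<longleftrightarrow> \<not> contains_forbidden_cohook n T"
proof -
  obtain r c where rc: "valid n r c" "T = build n r c T" using fb_tableau_eq_build[OF n T] .
  \<comment> \<open>Corners of forbidden cohooks avoid row 1, column \<open>n\<close> and the
    border, so they lie in the range of tag 2.\<close>
  have inner: "2 \<le> i \<and> i \<le> j \<and> j < n" if b: "(i, j) \<in> board n" and *: "r i < j" "i < c j" for i j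
  proof -
    have "i \<noteq> 1" using * b valid_D(1)[OF rc(1)] by (auto simp: board_def)
    moreover have "j \<noteq> n" using * b valid_D(2)[OF rc(1)] by (auto simp: board_def)
    moreover have "i - 1 \<noteq> j"
      using calculation * b valid_D(3)[OF rc(1), of i] by (auto simp: board_def)
    ultimately show ?thesis using b by (auto simp: board_def)
  qed
  have "contains_forbidden_cohook n T \<longleftrightarrow> enc False n T \<noteq> enc True n T"
  proof
    assume "contains_forbidden_cohook n T"
    then obtain i j where ij: "(i, j) \<in> board n" "r i < j" "i < c j"
      using forbidden_cohook_iff_build[OF n rc(1), of T] rc(2) by auto
    have "(2, (i, j)) \<in> enc True n (build n r c T)" "(2, (i, j)) \<notin> enc False n (build n r c T)"
      using inner[OF ij] ij unfolding enc_build[OF n rc(1)] by auto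
    then show "enc False n T \<noteq> enc True n T" using rc(2) by auto
  next
    assume ne: "enc False n T \<noteq> enc True n T"
    show "contains_forbidden_cohook n T"
    proof (rule ccontr)
      assume "\<not> contains_forbidden_cohook n T"
      then have g: "j \<le> r i \<or> c j \<le> i" if "(i, j) \<in> board n" for i j
        using that rc forbidden_cohook_iff_build[OF n rc(1), of T] by (metis not_le)
      have "enc True n (build n r c T) \<subseteq> enc False n (build n r c T)"
      proof (rule enc_subsetI, unfold enc_build[OF n rc(1)])
        fix i j
        assume a: "2 \<le> i \<and> i \<le> j \<and> j < n \<and>
          (if c j < i then j < r i \<longrightarrow> (i, j) \<in> T else r i \<le> j \<and> True)"
        then have "j \<le> r i \<or> c j \<le> i" using g[of i j] by (auto simp: board_def)
        moreover have "r i \<noteq> j \<or> c j < i" "c j \<noteq> i \<or> j < r i"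
          using a valid_D(5)[OF rc(1), of i] valid_D(8)[OF rc(1), of j] by auto
        ultimately show "2 \<le> i \<and> i \<le> j \<and> j < n \<and>
          (if c j < i then j < r i \<longrightarrow> (i, j) \<in> T else r i \<le> j \<and> False)"
          using a by (auto split: if_splits)
      qed
      then show False using ne rc(2) enc_False_subset_enc_True[of n T] by auto
    qed
  qed
  then show ?thesis
    using card_subset_eq[OF finite_enc enc_False_subset_enc_True] by auto
qed

theorem theorem7p7:
  fixes n :: nat and T :: "cell set"
  assumes "n > 0" and "fb_tableau n T"
  shows "T \<in> spine (esTam n) \<longleftrightarrow> \<not> contains_forbidden_cohook n T"
proof -
  have range: "(\<lambda>S. card (enc b n S)) ` D \<subseteq> {card (enc b n bot)..card (enc b n top)}"
    if "D \<in> Chains (esTam n)" "\<forall>S. fb_tableau n S \<longrightarrow> (bot, S) \<in> esTam n"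
      "\<forall>S. fb_tableau n S \<longrightarrow> (S, top) \<in> esTam n" for D bot top b
  proof -
    have "enc b n bot \<subseteq> enc b n S \<and> enc b n S \<subseteq> enc b n top" if "S \<in> D" for S
      using that \<open>D \<in> _\<close> \<open>\<forall>S. fb_tableau n S \<longrightarrow> (bot, S) \<in> _\<close> \<open>\<forall>S. fb_tableau n S \<longrightarrow> (S, top) \<in> _\<close>
        Chains_esTam_iff[of D n b] esTam_iff_enc[of _ _ n b] by blast
    then have "card (enc b n bot) \<le> card (enc b n S) \<and> card (enc b n S) \<le> card (enc b n top)"
      if "S \<in> D" for S
      using that by (meson card_mono finite_enc)
    then show ?thesis by auto
  qed
  \<comment> \<open>Ranks are injective on a chain and lie between those of the extremes, which
    bounds its length.\<close>
  have bound: "card D \<le> card {card (enc b n bot)..card (enc b n top)}"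
    if "D \<in> Chains (esTam n)" "\<forall>S. fb_tableau n S \<longrightarrow> (bot, S) \<in> esTam n"
      "\<forall>S. fb_tableau n S \<longrightarrow> (S, top) \<in> esTam n" for D bot top b
    by (rule card_inj_on_le[OF card_enc_inj_on range]) (use that in auto)
  show ?thesis
  proof
    assume "T \<in> spine (esTam n)"
    then obtain C where C: "C \<in> Chains (esTam n)" "T \<in> C" "\<forall>D \<in> Chains (esTam n). card D \<le> card C"
      by (auto simp: spine_def)
    \<comment> \<open>A saturated chain through any tableau without forbidden cohooks shows how long
      \<open>C\<close> must be.\<close>
    obtain T0 where "fb_tableau n T0" "\<not> contains_forbidden_cohook n T0"
      using exists_without_forbidden_cohook[OF assms(1)] by blast
    from long_chain_through[OF assms(1) this] obtain D bot top where
      D: "D \<in> Chains (esTam n)" and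
      bot: "fb_tableau n bot" "\<not> contains_forbidden_cohook n bot" "\<forall>S. fb_tableau n S \<longrightarrow> (bot, S) \<in> esTam n" and
      top: "fb_tableau n top" "\<not> contains_forbidden_cohook n top" "\<forall>S. fb_tableau n S \<longrightarrow> (S, top) \<in> esTam n" and
      card: "card (enc False n bot) + card D = card (enc False n top) + 1"
      by metis
    \<comment> \<open>The extremes have no ambiguous cells, so both ranks have the same
      range.\<close>
    have eq: "card (enc b n bot) = card (enc False n bot)" "card (enc b n top) = card (enc False n top)" for b
      using enc_ambiguous_iff[OF assms(1) bot(1)] bot(2) enc_ambiguous_iff[OF assms(1) top(1)] top(2)
      by (cases b; simp)+
    \<comment> \<open>\<open>C\<close> is at least as long as \<open>D\<close>, which has one
      element per rank, so for either \<open>b\<close> the ranks on \<open>C\<close> exhaust the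
      interval.\<close>
    have "bij_betw (\<lambda>S. card (enc b n S)) C {card (enc b n bot)..card (enc b n top)}" for b
    proof -
      have "card C \<ge> card D" using C(3) D by blast
      then have "card C \<ge> card {card (enc b n bot)..card (enc b n top)}" using card eq[of b] by simp
      moreover have "card ((\<lambda>S. card (enc b n S)) ` C) = card C"
        using card_enc_inj_on[OF C(1)] by (rule card_image)
      ultimately have "(\<lambda>S. card (enc b n S)) ` C = {card (enc b n bot)..card (enc b n top)}"
        using range[OF C(1) bot(3) top(3), of b] by (intro card_seteq) auto
      then show ?thesis using card_enc_inj_on[OF C(1)] by (simp add: bij_betw_def)
    qed
    from bij_betw_rank[OF this C(2)]
    have rank: "card (enc b n T) = card (enc b n bot) + card {S \<in> C. card (enc b n S) < card (enc b n T)}" for b .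
    \<comment> \<open>The set of members of \<open>C\<close> below \<open>T\<close> depends on the
      order alone, so the rank formula gives the same value for both Booleans.\<close>
    have "{S \<in> C. card (enc b n S) < card (enc b n T)} = {S \<in> C. (S, T) \<in> esTam n \<and> S \<noteq> T}" for b
      by (intro Collect_cong conj_cong refl card_enc_less_iff[OF C(1) _ C(2)])
    then have "card (enc b n T) = card (enc False n bot) + card {S \<in> C. (S, T) \<in> esTam n \<and> S \<noteq> T}" for b
      using rank[of b] eq(1)[of b] by presburger
    then have "card (enc False n T) = card (enc True n T)" by presburger
    then show "\<not> contains_forbidden_cohook n T" using enc_ambiguous_iff[OF assms] by blast
  next
    assume "\<not> contains_forbidden_cohook n T"
    from long_chain_through[OF assms this] obtain C bot top where
      C: "C \<in> Chains (esTam n)" "T \<in> C" and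
      bt: "\<forall>S. fb_tableau n S \<longrightarrow> (bot, S) \<in> esTam n" "\<forall>S. fb_tableau n S \<longrightarrow> (S, top) \<in> esTam n" and
      card: "card (enc False n bot) + card C = card (enc False n top) + 1"
      by metis
    have "card D \<le> card C" if "D \<in> Chains (esTam n)" for D
      using bound[OF that bt, of False] card by simp
    with C show "T \<in> spine (esTam n)" by (auto simp: spine_def)
  qed
qed

end
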